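(* Let $G$ be an analytic graph on a Polish space $X=V(G)$. If $\chi_B(G)>2$, then $V(G)$ is large.
   Context: An analytic graph on a Polish space $X$ is a symmetric irreflexive analytic relation $G\subseteq X\times X$; $\chi_B(G)$ is the least $k$ such that there is a Borel map $c\colon X\to k$ with $c(x)\ne c(y)$ whenever $(x,y)\in G$. For an analytic $A\subseteq V(G)$ and $k<\omega$, $\Phi(A,k)$ means: every walk in $G$ of odd length with both endpoints in $A$ has length at most $2k-1$. A Borel set $A\subseteq V(G)$ is tiny if $\Phi(A,k)$ holds for some $k<\omega$. A set $S\subseteq V(G)$ is small if it is a countable union of tiny sets, and large if it is not small. *)

theory Defs
  imports "HOL-Analysis.Analysis" "HOL-Library.Extended_Nat"
begin

text \<open>Analytic (\<open>\<Sigma>\<^sup>1\<^sub>1\<close>) sets as continuous images of the Baire space; the type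
  \<^typ>\<open>nat \<Rightarrow> nat\<close> carries the product topology of the discrete topology on \<^typ>\<open>nat\<close>.\<close>

definition analytic_set :: "'a::topological_space set \<Rightarrow> bool" where
  "analytic_set A \<longleftrightarrow> A = {} \<or> (\<exists>f :: (nat \<Rightarrow> nat) \<Rightarrow> 'a. continuous_on UNIV f \<and> range f = A)"

definition analytic_graph :: "('a::polish_space \<times> 'a) set \<Rightarrow> bool" where
  "analytic_graph G \<longleftrightarrow> sym G \<and> irrefl G \<and> analytic_set G"

definition borel_coloring :: "('a::polish_space \<times> 'a) set \<Rightarrow> nat \<Rightarrow> ('a \<Rightarrow> nat) \<Rightarrow> bool" where
  "borel_coloring G k c \<longleftrightarrow>
     c \<in> borel \<rightarrow>\<^sub>M count_space {..<k} \<and> (\<forall>x y. (x, y) \<in> G \<longrightarrow> c x \<noteq> c y)"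

text \<open>The value is \<open>\<infinity>\<close> when no finite \<open>k\<close> works; infinite Borel chromatic numbers are not
  distinguished from one another.\<close>

definition borel_chromatic_number :: "('a::polish_space \<times> 'a) set \<Rightarrow> enat" where
  "borel_chromatic_number G = Inf {enat k | k. \<exists>c. borel_coloring G k c}"

definition walk :: "('a \<times> 'a) set \<Rightarrow> 'a list \<Rightarrow> bool" where
  "walk G p \<longleftrightarrow> p \<noteq> [] \<and> successively (\<lambda>x y. (x, y) \<in> G) p"

text \<open>The length of a walk is its number of edges; vertices and edges may repeat.\<close>

definition walk_length :: "'a list \<Rightarrow> nat" where
  "walk_length p = length p - 1"

text \<open>Integers, because \<open>2k - 1\<close> is negative for \<open>k = 0\<close>.\<close>

definition Phi :: "('a \<times> 'a) set \<Rightarrow> 'a set \<Rightarrow> nat \<Rightarrow> bool" where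
  "Phi G A k \<longleftrightarrow>
     (\<forall>p. walk G p \<and> odd (walk_length p) \<and> hd p \<in> A \<and> last p \<in> A
        \<longrightarrow> int (walk_length p) \<le> 2 * int k - 1)"

definition tiny :: "('a::polish_space \<times> 'a) set \<Rightarrow> 'a set \<Rightarrow> bool" where
  "tiny G A \<longleftrightarrow> A \<in> sets borel \<and> (\<exists>k. Phi G A k)"

definition small :: "('a::polish_space \<times> 'a) set \<Rightarrow> 'a set \<Rightarrow> bool" where
  "small G S \<longleftrightarrow> (\<exists>\<A>. countable \<A> \<and> (\<forall>A\<in>\<A>. tiny G A) \<and> S = \<Union>\<A>)"

definition large :: "('a::polish_space \<times> 'a) set \<Rightarrow> 'a set \<Rightarrow> bool" where
  "large G S \<longleftrightarrow> \<not> small G S"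

end

theory Submission
  imports Defs
begin

text \<open>
  A nontrivial odd walk can be lengthened by going back and forth along its first edge, so a tiny
  set is one without any odd walk between its points. By Lusin separation, a Suslin set without
  odd walks lies in a Borel set without odd walks. Starting with a tiny set and alternately taking
  neighbours and enlarging to a Borel set gives \<open>B\<^sub>0, B\<^sub>1, \<dots>\<close>; the unions \<open>P\<close> and \<open>Q\<close> over the even
  and the odd indices are Borel and independent, and \<open>G\<close> maps each into the other. If countably
  many tiny sets cover the space, then so do the unions \<open>P\<^sub>n \<union> Q\<^sub>n\<close>, which are closed under
  adjacency; giving \<open>x\<close> colour 0 iff \<open>x \<in> P\<^sub>n\<close> for the least \<open>n\<close> with \<open>x \<in> P\<^sub>n \<union> Q\<^sub>n\<close> is a Borel
  2-colouring.
\<close>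

section \<open>Suslin sets\<close>

text \<open>Closed subsets of the Baire space are allowed as domains, which makes closure under
  countable intersections immediate; no retraction onto a closed set is needed.\<close>

definition suslin :: "'a::topological_space set \<Rightarrow> bool" where
  "suslin A \<longleftrightarrow> (\<exists>(C :: (nat \<Rightarrow> nat) set) f. closed C \<and> continuous_on C f \<and> f ` C = A)"

lemma suslinI:
  fixes C :: "(nat \<Rightarrow> nat) set"
  assumes "closed C" "continuous_on C f" "f ` C = A"
  shows "suslin A"
  using assms unfolding suslin_def by blast

lemma suslinE:
  assumes "suslin A"
  obtains C :: "(nat \<Rightarrow> nat) set" and f where "closed C" "continuous_on C f" "f ` C = A"
  using assms unfolding suslin_def by blast

lemma suslin_empty: "suslin {}"
  by (rule suslinI[of "{}"]) auto

lemma suslin_image: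
  assumes "suslin A" "continuous_on A f"
  shows "suslin (f ` A)"
proof -
  obtain C :: "(nat \<Rightarrow> nat) set" and g where C: "closed C" "continuous_on C g" "g ` C = A"
    using assms(1) by (rule suslinE)
  show ?thesis
    using C assms(2) by (intro suslinI[of C "f \<circ> g"] continuous_on_compose) auto
qed

lemma open_baire_coordinate: "open {z :: nat \<Rightarrow> nat. z i \<in> S}"
proof -
  have "open ((\<lambda>z :: nat \<Rightarrow> nat. z i) -` S)"
    by (intro open_vimage continuous_on_product_coordinates open_discrete)
  then show ?thesis
    by (simp add: vimage_def)
qed

lemma closed_baire_coordinate: "closed {z :: nat \<Rightarrow> nat. z i \<in> S}"
  using open_baire_coordinate[of i "- S"] by (simp add: closed_def Compl_eq)

text \<open>The first coordinate of a sequence selects the set \<open>A n\<close> and the remaining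
  ones form a point of its domain, so the countably many domains sit side by side in a single closed
  set.\<close>

lemma suslin_UN:
  fixes A :: "nat \<Rightarrow> 'a::topological_space set"
  assumes "\<And>n. suslin (A n)"
  shows "suslin (\<Union>n. A n)"
proof -
  obtain C :: "nat \<Rightarrow> (nat \<Rightarrow> nat) set" and f where
    C: "\<And>n. closed (C n)" and f: "\<And>n. continuous_on (C n) (f n)" and A: "\<And>n. f n ` C n = A n"
    using assms unfolding suslin_def by metis
  define sh :: "(nat \<Rightarrow> nat) \<Rightarrow> nat \<Rightarrow> nat" where "sh = (\<lambda>z k. z (Suc k))"
  have sh: "continuous_on S sh" for S
    unfolding sh_def
    by (intro continuous_on_coordinatewise_then_product
        continuous_on_subset[OF continuous_on_product_coordinates]) auto
  \<comment> \<open>Written this way, \<open>D\<close> is visibly closed: each member of the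
    intersection is a union of two closed sets.\<close>
  define D where "D = (\<Inter>n. {z. z 0 \<in> - {n}} \<union> sh -` C n)"
  define F where "F = (\<lambda>z. f (z 0) (sh z))"
  have D: "z \<in> D \<longleftrightarrow> sh z \<in> C (z 0)" for z
    unfolding D_def by auto
  show ?thesis
  proof (rule suslinI)
    show "closed D"
      unfolding D_def
      by (intro closed_INT ballI closed_Un closed_baire_coordinate closed_vimage C sh)
    show "continuous_on D F"
      unfolding continuous_on_open_invariant
    proof (intro allI impI)
      fix U :: "'a set"
      assume "open U"
      then have "\<forall>n. \<exists>V. open V \<and> V \<inter> C n = f n -` U \<inter> C n"
        using f unfolding continuous_on_open_invariant by blast
      then obtain V where V: "\<And>n. open (V n)" "\<And>n. V n \<inter> C n = f n -` U \<inter> C n"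
        by metis
      show "\<exists>W. open W \<and> W \<inter> D = F -` U \<inter> D"
      proof (intro exI conjI)
        \<comment> \<open>On the open piece where \<open>z 0\<close> is n, the map is
          \<open>f n\<close> after the shift, so continuity can be checked piece by piece.\<close>
        show "open (\<Union>n. {z. z 0 \<in> {n}} \<inter> sh -` V n)"
          by (intro open_UN ballI open_Int open_baire_coordinate open_vimage V sh)
        show "(\<Union>n. {z. z 0 \<in> {n}} \<inter> sh -` V n) \<inter> D = F -` U \<inter> D"
        proof -
          have "sh z \<in> V (z 0) \<longleftrightarrow> F z \<in> U" if "z \<in> D" for z
            using V(2)[of "z 0"] that unfolding F_def D by blast
          then show ?thesis
            by auto
        qed
      qed
    qed
    show "F ` D = (\<Union>n. A n)"
    proof
      show "F ` D \<subseteq> (\<Union>n. A n)"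
        using A unfolding F_def by (blast intro: D[THEN iffD1])
      show "(\<Union>n. A n) \<subseteq> F ` D"
      proof
        fix a assume "a \<in> (\<Union>n. A n)"
        then obtain n x where "x \<in> C n" "a = f n x"
          using A by blast
        moreover have "sh (case_nat n x) = x"
          by (simp add: sh_def)
        ultimately show "a \<in> F ` D"
          by (intro image_eqI[of _ _ "case_nat n x"]) (auto simp: D F_def)
      qed
    qed
  qed
qed

text \<open>A single point of the Baire space codes a whole sequence of such points.\<close>

definition baire_row :: "(nat \<Rightarrow> nat) \<Rightarrow> nat \<Rightarrow> nat \<Rightarrow> nat" where
  "baire_row z n k = z (prod_encode (n, k))"

lemma continuous_on_baire_row: "continuous_on S (\<lambda>z. baire_row z n)"
  unfolding baire_row_def
  by (intro continuous_on_coordinatewise_then_product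
      continuous_on_subset[OF continuous_on_product_coordinates]) auto

lemma baire_row_surj: "\<exists>z. baire_row z = g"
proof
  show "baire_row (\<lambda>m. case prod_decode m of (n, k) \<Rightarrow> g n k) = g"
    by (auto simp: baire_row_def fun_eq_iff)
qed

lemma closed_equalizer_on:
  fixes f g :: "'a::topological_space \<Rightarrow> 'b::t2_space"
  assumes "closed S" "continuous_on S f" "continuous_on S g"
  shows "closed {x \<in> S. f x = g x}"
proof -
  have "closed (S \<inter> (\<lambda>x. (f x, g x)) -` {y. \<exists>x. y = (x, x)})"
    using assms by (intro continuous_closed_preimage continuous_intros closed_diagonal)
  also have "S \<inter> (\<lambda>x. (f x, g x)) -` {y. \<exists>x. y = (x, x)} = {x \<in> S. f x = g x}"
    by auto
  finally show ?thesis .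
qed

text \<open>Stated for product spaces and proved coordinatewise, because the type \<^typ>\<open>nat \<Rightarrow> nat\<close> is
  not known to be an instance of \<^class>\<open>t2_space\<close>.\<close>

lemma suslin_INT:
  fixes A :: "nat \<Rightarrow> ('i \<Rightarrow> 'a::t2_space) set"
  assumes "\<And>n. suslin (A n)"
  shows "suslin (\<Inter>n. A n)"
proof -
  obtain C :: "nat \<Rightarrow> (nat \<Rightarrow> nat) set" and f where
    C: "\<And>n. closed (C n)" and f: "\<And>n. continuous_on (C n) (f n)" and A: "\<And>n. f n ` C n = A n"
    using assms unfolding suslin_def by metis
  define D where "D = (\<Inter>n. (\<lambda>z. baire_row z n) -` C n)"
  \<comment> \<open>A code in \<open>E\<close> supplies preimages under all the maps at once: its
    rows all have the same image, so \<open>E\<close> is a countable fibre product.\<close>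
  define E where "E = (\<Inter>n. \<Inter>i. {z \<in> D. f n (baire_row z n) i = f 0 (baire_row z 0) i})"
  have D: "closed D"
    unfolding D_def by (intro closed_INT ballI closed_vimage C continuous_on_baire_row)
  have cont: "continuous_on D (\<lambda>z. f n (baire_row z n))" for n
    by (rule continuous_on_compose2[OF f continuous_on_baire_row]) (auto simp: D_def)
  show ?thesis
  proof (rule suslinI)
    show "closed E"
      unfolding E_def by (intro closed_INT ballI closed_equalizer_on D
          continuous_on_product_then_coordinatewise[OF cont])
    show "continuous_on E (\<lambda>z. f 0 (baire_row z 0))"
      by (rule continuous_on_subset[OF cont]) (auto simp: E_def)
    show "(\<lambda>z. f 0 (baire_row z 0)) ` E = (\<Inter>n. A n)"
    proof (intro equalityI subsetI)
      fix a assume "a \<in> (\<lambda>z. f 0 (baire_row z 0)) ` E"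
      then obtain z where z: "z \<in> E" "a = f 0 (baire_row z 0)"
        by blast
      have "f n (baire_row z n) = a" "baire_row z n \<in> C n" for n
        using z by (auto simp: E_def D_def fun_eq_iff)
      then have "a \<in> f n ` C n" for n
        by (metis imageI)
      then show "a \<in> (\<Inter>n. A n)"
        by (simp add: A)
    next
      fix a assume "a \<in> (\<Inter>n. A n)"
      then have "a \<in> f n ` C n" for n
        by (simp add: A)
      then have "\<forall>n. \<exists>x \<in> C n. f n x = a"
        by (metis imageE)
      then obtain g where g: "\<And>n. g n \<in> C n" "\<And>n. f n (g n) = a"
        by metis
      obtain z where "baire_row z = g"
        using baire_row_surj by blast
      with g show "a \<in> (\<lambda>z. f 0 (baire_row z 0)) ` E"
        by (intro image_eqI[of _ _ z]) (auto simp: E_def D_def)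
    qed
  qed
qed

section \<open>Borel subsets of the Baire space and images of Borel sets\<close>

lemma suslin_closed_baire:
  fixes C :: "(nat \<Rightarrow> nat) set"
  shows "closed C \<Longrightarrow> suslin C"
  by (rule suslinI[of C id]) auto

text \<open>The sets that are Suslin together with their complements form a sigma-algebra, and the
  generating sets, which restrict a single coordinate, are clopen.\<close>

lemma suslin_borel_baire:
  fixes B :: "(nat \<Rightarrow> nat) set"
  assumes "B \<in> sets borel"
  shows "suslin B"
proof -
  have "B \<in> sets (PiM UNIV (\<lambda>_ :: nat. borel :: nat measure))"
    using assms by (simp only: sets_PiM_equal_borel)
  then have "B \<in> sigma_sets UNIV {{z. z i \<in> S} | i S. True}"
    unfolding sets_PiM_single PiE_UNIV_domain space_borel Pi_UNIV
    by (rule rev_subsetD[OF _ sigma_sets_mono']) auto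
  then have "suslin B \<and> suslin (- B)"
  proof induction
    case (Basic a)
    then obtain i and S :: "nat set" where "a = {z. z i \<in> S}"
      by blast
    then show ?case
      using closed_baire_coordinate open_baire_coordinate
      by (auto intro!: suslin_closed_baire simp: closed_def)
  next
    case Empty
    show ?case
      by (auto intro: suslin_closed_baire)
  next
    case (Compl a)
    then show ?case
      by (simp add: Compl_eq_Diff_UNIV[symmetric])
  next
    case (Union a)
    have "suslin (\<Union>i. a i)"
      by (rule suslin_UN) (use Union in blast)
    moreover have "suslin (\<Inter>i. - a i)"
      by (rule suslin_INT) (use Union in blast)
    ultimately show ?case
      by simp
  qed
  then show ?thesis
    by blast
qed

text \<open>\<open>B\<close> is pulled back to the domain of a parametrisation of \<open>R\<close>.
  This preimage is a Borel subset of the Baire space, hence Suslin, and the second component maps it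
  onto the image.\<close>

lemma suslin_Image_borel:
  fixes R :: "('a::topological_space \<times> 'b::topological_space) set"
  assumes "suslin R" "B \<in> sets borel"
  shows "suslin (R `` B)"
proof -
  obtain C :: "(nat \<Rightarrow> nat) set" and f where C: "closed C" "continuous_on C f" "f ` C = R"
    using assms(1) by (rule suslinE)
  have "(\<lambda>z. fst (f z)) \<in> borel_measurable (restrict_space borel C)"
    using C by (intro borel_measurable_continuous_on_restrict continuous_intros)
  from measurable_sets[OF this assms(2)]
  have "(\<lambda>z. fst (f z)) -` B \<inter> C \<in> sets borel"
    using C(1) by (simp add: space_restrict_space sets_restrict_space_iff)
  then have "suslin ((\<lambda>z. snd (f z)) ` ((\<lambda>z. fst (f z)) -` B \<inter> C))"
    using C by (intro suslin_image suslin_borel_baire continuous_intros)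
      (auto intro: continuous_on_subset)
  also have "(\<lambda>z. snd (f z)) ` ((\<lambda>z. fst (f z)) -` B \<inter> C) = R `` B"
  proof (intro equalityI subsetI)
    fix y assume "y \<in> R `` B"
    then obtain x where "x \<in> B" "(x, y) \<in> f ` C"
      using C(3) by blast
    then obtain z where "z \<in> C" "fst (f z) \<in> B" "y = snd (f z)"
      by (metis imageE fst_conv snd_conv)
    then show "y \<in> (\<lambda>z. snd (f z)) ` ((\<lambda>z. fst (f z)) -` B \<inter> C)"
      by blast
  next
    fix y assume "y \<in> (\<lambda>z. snd (f z)) ` ((\<lambda>z. fst (f z)) -` B \<inter> C)"
    then obtain z where z: "z \<in> C" "fst (f z) \<in> B" "y = snd (f z)"
      by blast
    then have "(fst (f z), y) \<in> R"
      using C(3) by auto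
    with z(2) show "y \<in> R `` B"
      by blast
  qed
  finally show ?thesis .
qed

section \<open>Lusin separation\<close>

definition borel_separated :: "'a::topological_space set \<Rightarrow> 'a set \<Rightarrow> bool" where
  "borel_separated A B \<longleftrightarrow> (\<exists>D \<in> sets borel. A \<subseteq> D \<and> B \<inter> D = {})"

lemma borel_separatedE:
  assumes "borel_separated A B"
  obtains D where "D \<in> sets borel" "A \<subseteq> D" "B \<inter> D = {}"
  using assms unfolding borel_separated_def by blast

lemma borel_separated_empty: "borel_separated {} B" "borel_separated A {}"
  unfolding borel_separated_def by auto

text \<open>If \<open>D i j\<close> separates \<open>A i\<close> from \<open>B j\<close>, then the
  union over i of the intersections over j separates the unions. Read contrapositively, an
  inseparable pair of unions has an inseparable pair of members, which drives the proof of Lusin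
  separation.\<close>

lemma borel_separated_UN:
  fixes A B :: "nat \<Rightarrow> 'a::topological_space set"
  assumes "\<And>i j. borel_separated (A i) (B j)"
  shows "borel_separated (\<Union>i. A i) (\<Union>j. B j)"
proof -
  obtain D where D: "\<And>i j. D i j \<in> sets borel" "\<And>i j. A i \<subseteq> D i j" "\<And>i j. B j \<inter> D i j = {}"
    using assms unfolding borel_separated_def by metis
  have "(\<Union>i. \<Inter>j. D i j) \<in> sets borel"
    using D(1) by auto
  then show ?thesis
    unfolding borel_separated_def
  proof (intro bexI conjI)
    show "(\<Union>i. A i) \<subseteq> (\<Union>i. \<Inter>j. D i j)"
      using D(2) by (intro UN_mono INT_greatest) auto
    show "(\<Union>j. B j) \<inter> (\<Union>i. \<Inter>j. D i j) = {}"
    proof (rule equals0I)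
      fix x assume "x \<in> (\<Union>j. B j) \<inter> (\<Union>i. \<Inter>j. D i j)"
      then obtain i j where "x \<in> B j" "x \<in> D i j"
        by auto
      with D(3)[of j i] show False
        by auto
    qed
  qed
qed

text \<open>Using a full sequence instead of a finite word makes a one-step extension a function
  update.\<close>

definition cylinder :: "(nat \<Rightarrow> nat) \<Rightarrow> nat \<Rightarrow> (nat \<Rightarrow> nat) set" where
  "cylinder x n = {z. \<forall>k<n. z k = x k}"

lemma cylinder_mono: "m \<le> n \<Longrightarrow> cylinder x n \<subseteq> cylinder x m"
  by (auto simp: cylinder_def)

lemma cylinder_Suc: "cylinder x n = (\<Union>i. cylinder (x(n := i)) (Suc n))"
  by (auto simp: cylinder_def less_Suc_eq)

lemma open_contains_cylinder:
  assumes "open U" "x \<in> U"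
  obtains n where "cylinder x n \<subseteq> U"
proof -
  have "openin (product_topology (\<lambda>_. euclidean) UNIV) U"
    using assms(1) by (simp add: open_fun_def)
  from product_topology_open_contains_basis[OF this assms(2)]
  obtain X where X: "x \<in> (\<Pi>\<^sub>E i\<in>UNIV. X i)" "finite {i. X i \<noteq> UNIV}" "(\<Pi>\<^sub>E i\<in>UNIV. X i) \<subseteq> U"
    by auto
  \<comment> \<open>\<open>n\<close> bounds the finitely many coordinates that the basic open set
    restricts.\<close>
  obtain n where n: "\<And>i. X i \<noteq> UNIV \<Longrightarrow> i < n"
    using X(2) unfolding finite_nat_set_iff_bounded by blast
  have "cylinder x n \<subseteq> (\<Pi>\<^sub>E i\<in>UNIV. X i)"
  proof
    fix z assume z: "z \<in> cylinder x n"
    have "z i \<in> X i" for i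
      using n[of i] z X(1) by (cases "X i = UNIV") (auto simp: cylinder_def PiE_iff)
    then show "z \<in> (\<Pi>\<^sub>E i\<in>UNIV. X i)"
      by (simp add: PiE_iff)
  qed
  with X(3) show thesis
    using that by blast
qed

lemma closed_meets_cylinders:
  assumes "closed C" "\<And>n. C \<inter> cylinder x n \<noteq> {}"
  shows "x \<in> C"
proof (rule ccontr)
  assume "x \<notin> C"
  then obtain n where "cylinder x n \<subseteq> - C"
    using assms(1) open_contains_cylinder[of "- C" x] by (auto simp: closed_def)
  with assms(2)[of n] show False
    by blast
qed

lemma continuous_on_cylinder:
  assumes "continuous_on C f" "x \<in> C" "open U" "f x \<in> U"
  obtains n where "f ` (C \<inter> cylinder x n) \<subseteq> U"
proof -
  obtain V where V: "open V" "V \<inter> C = f -` U \<inter> C"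
    using assms(1,3) unfolding continuous_on_open_invariant by metis
  have "x \<in> V"
    using V(2) assms(2,4) by blast
  with V(1) obtain n where "cylinder x n \<subseteq> V"
    by (rule open_contains_cylinder)
  with V(2) show thesis
    by (intro that[of n]) blast
qed

text \<open>If separation fails, it fails at every depth for the images of some pair of nested
  cylinders. These shrink to points with distinct images, and by continuity disjoint open
  neighbourhoods of the two images separate the images of small enough cylinders.\<close>

theorem lusin_separation:
  fixes A B :: "'a::t2_space set"
  assumes "suslin A" "suslin B" "A \<inter> B = {}"
  shows "borel_separated A B"
proof (rule ccontr)
  assume nsep: "\<not> borel_separated A B"
  obtain C :: "(nat \<Rightarrow> nat) set" and f where C: "closed C" "continuous_on C f" "f ` C = A"
    using assms(1) by (rule suslinE)
  obtain D :: "(nat \<Rightarrow> nat) set" and g where D: "closed D" "continuous_on D g" "g ` D = B"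
    using assms(2) by (rule suslinE)
  define N where "N = (\<lambda>n (x, y). \<not> borel_separated (f ` (C \<inter> cylinder x n)) (g ` (D \<inter> cylinder y n)))"
  \<comment> \<open>Coherence of successive choices, so that they converge to a pair of
    branches.\<close>
  define agree :: "nat \<Rightarrow> (nat \<Rightarrow> nat) \<times> (nat \<Rightarrow> nat) \<Rightarrow> (nat \<Rightarrow> nat) \<times> (nat \<Rightarrow> nat) \<Rightarrow> bool"
    where "agree = (\<lambda>n (x, y) (x', y'). \<forall>k<n. x' k = x k \<and> y' k = y k)"
  have "\<exists>s. \<forall>n. N n (s n) \<and> agree n (s n) (s (Suc n))"
  proof (rule dependent_nat_choice)
    have "N 0 (x, y)" for x y
      using nsep C(3) D(3) by (simp add: N_def cylinder_def)
    then show "\<exists>p. N 0 p"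
      by blast
  next
    fix p n assume N: "N n p"
    obtain x y where p: "p = (x, y)"
      by force
    have "\<exists>i j. \<not> borel_separated (f ` (C \<inter> cylinder (x(n := i)) (Suc n)))
                                (g ` (D \<inter> cylinder (y(n := j)) (Suc n)))"
    proof (rule ccontr)
      assume "\<not> ?thesis"
      then have "borel_separated (\<Union>i. f ` (C \<inter> cylinder (x(n := i)) (Suc n)))
                                 (\<Union>j. g ` (D \<inter> cylinder (y(n := j)) (Suc n)))"
        by (intro borel_separated_UN) blast
      moreover have "h ` (S \<inter> cylinder w n) = (\<Union>i. h ` (S \<inter> cylinder (w(n := i)) (Suc n)))"
        for h :: "(nat \<Rightarrow> nat) \<Rightarrow> 'a" and S w
        by (subst cylinder_Suc) blast
      ultimately show False
        using N unfolding p N_def by (metis case_prod_conv)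
    qed
    then obtain i j where "N (Suc n) (x(n := i), y(n := j))"
      unfolding N_def by auto
    then show "\<exists>q. N (Suc n) q \<and> agree n p q"
      by (intro exI[of _ "(x(n := i), y(n := j))"]) (auto simp: agree_def p)
  qed
  then obtain s where s: "\<And>n. N n (s n)" "\<And>n. agree n (s n) (s (Suc n))"
    by blast
  \<comment> \<open>Coordinate k is chosen in passing to stage \<open>Suc k\<close> and never
    changes afterwards.\<close>
  define x where "x = (\<lambda>k. fst (s (Suc k)) k)"
  define y where "y = (\<lambda>k. snd (s (Suc k)) k)"
  have "\<forall>k<n. fst (s n) k = x k \<and> snd (s n) k = y k" for n
  proof (induction n)
    case (Suc n)
    then show ?case
      using s(2)[of n] by (auto simp: agree_def x_def y_def less_Suc_eq split: prod.splits)
  qed simp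
  then have "cylinder (fst (s n)) n = cylinder x n" "cylinder (snd (s n)) n = cylinder y n" for n
    by (auto simp: cylinder_def)
  with s(1) have N: "\<not> borel_separated (f ` (C \<inter> cylinder x n)) (g ` (D \<inter> cylinder y n))" for n
    by (metis (no_types, lifting) N_def case_prod_beta)
  \<comment> \<open>The empty set is separated from every set, so an inseparable pair has no empty
    member.\<close>
  have "C \<inter> cylinder x n \<noteq> {}" "D \<inter> cylinder y n \<noteq> {}" for n
    using N[of n] borel_separated_empty by (metis image_empty)+
  then have xy: "x \<in> C" "y \<in> D"
    using closed_meets_cylinders C(1) D(1) by blast+
  then have "f x \<noteq> g y"
    using assms(3) C(3) D(3) by blast
  from hausdorff[OF this]
  obtain U V where UV: "open U" "open V" "f x \<in> U" "g y \<in> V" "U \<inter> V = {}"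
    by metis
  obtain m where m: "f ` (C \<inter> cylinder x m) \<subseteq> U"
    by (rule continuous_on_cylinder[OF C(2), OF xy(1) UV(1,3)])
  obtain n where n: "g ` (D \<inter> cylinder y n) \<subseteq> V"
    by (rule continuous_on_cylinder[OF D(2), OF xy(2) UV(2,4)])
  have "f ` (C \<inter> cylinder x (max m n)) \<subseteq> U" "g ` (D \<inter> cylinder y (max m n)) \<subseteq> V"
    using m n cylinder_mono[of m "max m n" x] cylinder_mono[of n "max m n" y] by fastforce+
  then have "borel_separated (f ` (C \<inter> cylinder x (max m n))) (g ` (D \<inter> cylinder y (max m n)))"
    unfolding borel_separated_def using UV by (intro bexI[of _ U]) auto
  with N show False
    by blast
qed

text \<open>Separation is applied twice. First \<open>U\<close> contains \<open>A\<close> and misses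
  the \<open>R\<close>-neighbours of \<open>A\<close>. By symmetry \<open>A\<close> misses the
  \<open>R\<close>-neighbours of \<open>U\<close>, which form a Suslin set because \<open>U\<close>
  is Borel, so some Borel \<open>V\<close> contains \<open>A\<close> and misses them. The
  intersection of \<open>U\<close> and \<open>V\<close> is independent.\<close>

lemma borel_independent_superset:
  fixes R :: "('a::t2_space \<times> 'a) set"
  assumes R: "suslin R" "sym R" and A: "suslin A" "suslin (R `` A)" "A \<inter> R `` A = {}"
  obtains B where "B \<in> sets borel" "A \<subseteq> B" "B \<inter> R `` B = {}"
proof -
  obtain U where U: "U \<in> sets borel" "A \<subseteq> U" "R `` A \<inter> U = {}"
    using lusin_separation[OF A] by (rule borel_separatedE)
  have "A \<inter> R `` U = {}"
    using U(3) symD[OF \<open>sym R\<close>] by blast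
  then obtain V where V: "V \<in> sets borel" "A \<subseteq> V" "R `` U \<inter> V = {}"
    using lusin_separation[OF A(1) suslin_Image_borel[OF R(1) U(1)]] borel_separatedE by metis
  show thesis
  proof
    show "U \<inter> V \<in> sets borel" "A \<subseteq> U \<inter> V" "(U \<inter> V) \<inter> R `` (U \<inter> V) = {}"
      using U V by auto
  qed
qed

section \<open>Walks\<close>

text \<open>The rows of a code give the edges of a walk, and it is a closed condition that
  consecutive edges fit together. Power 0 is left out: it is the diagonal, which need not be Suslin
  in a Hausdorff space.\<close>

lemma suslin_relpow_Suc:
  fixes G :: "('a::t2_space \<times> 'a) set"
  assumes "analytic_set G"
  shows "suslin (G ^^ Suc n)"
proof (cases "G = {}")
  case True
  then show ?thesis
    by (simp add: suslin_empty)
next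
  case False
  with assms obtain f :: "(nat \<Rightarrow> nat) \<Rightarrow> 'a \<times> 'a" where f: "continuous_on UNIV f" "range f = G"
    unfolding analytic_set_def by blast
  define p where "p = (\<lambda>z i. f (baire_row z i))"
  have p: "continuous_on S (\<lambda>z. p z i)" for S i
    unfolding p_def by (rule continuous_on_compose2[OF f(1) continuous_on_baire_row]) auto
  define C where "C = (\<Inter>i\<in>{..<n}. {z \<in> UNIV. snd (p z i) = fst (p z (Suc i))})"
  show ?thesis
  proof (rule suslinI)
    show "closed C"
      unfolding C_def by (intro closed_INT ballI closed_equalizer_on continuous_intros p closed_UNIV)
    show "continuous_on C (\<lambda>z. (fst (p z 0), snd (p z n)))"
      by (intro continuous_intros p)
    show "(\<lambda>z. (fst (p z 0), snd (p z n))) ` C = G ^^ Suc n"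
    proof (intro equalityI subsetI)
      fix e assume "e \<in> (\<lambda>z. (fst (p z 0), snd (p z n))) ` C"
      then obtain z where z: "z \<in> C" "e = (fst (p z 0), snd (p z n))"
        by blast
      \<comment> \<open>The vertices of the walk: the start of the first edge, then the end of each
        edge.\<close>
      define w where "w = case_nat (fst (p z 0)) (\<lambda>i. snd (p z i))"
      have "(w i, w (Suc i)) = p z i" if "i < Suc n" for i
        using that z(1) by (cases i) (auto simp: w_def C_def prod_eq_iff)
      moreover have "p z i \<in> G" for i
        unfolding p_def using f(2) by blast
      ultimately show "e \<in> G ^^ Suc n"
        unfolding z(2) relpow_fun_conv by (intro exI[of _ w]) (auto simp: w_def)
    next
      fix e assume "e \<in> G ^^ Suc n"
      then obtain w where w: "e = (w 0, w (Suc n))" "\<forall>i<Suc n. (w i, w (Suc i)) \<in> G"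
        by (metis relpow_fun_conv surj_pair)
      then have "\<forall>i. \<exists>y. i < Suc n \<longrightarrow> f y = (w i, w (Suc i))"
        using f(2) by (metis imageE)
      then obtain g where g: "\<And>i. i < Suc n \<Longrightarrow> f (g i) = (w i, w (Suc i))"
        by metis
      obtain z where "baire_row z = g"
        using baire_row_surj by blast
      then have "p z i = (w i, w (Suc i))" if "i < Suc n" for i
        using g that by (simp add: p_def)
      then show "e \<in> (\<lambda>z. (fst (p z 0), snd (p z n))) ` C"
        by (intro image_eqI[of _ _ z]) (auto simp: C_def w(1))
    qed
  qed
qed

section \<open>Pairs joined by odd walks\<close>

definition odd_reach :: "('a \<times> 'a) set \<Rightarrow> ('a \<times> 'a) set" where
  "odd_reach G = (\<Union>n. G ^^ Suc (2 * n))"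

text \<open>The composite serves odd walks that start at neighbours of a Borel set: the set of
  neighbours is only known to be Suslin, whereas \<open>suslin_Image_borel\<close> takes a Borel
  set.\<close>

lemma suslin_odd_reach:
  fixes G :: "('a::t2_space \<times> 'a) set"
  assumes "analytic_set G"
  shows "suslin (odd_reach G)" "suslin (G O odd_reach G)"
proof -
  show "suslin (odd_reach G)"
    unfolding odd_reach_def by (intro suslin_UN suslin_relpow_Suc assms)
  have "G O odd_reach G = (\<Union>n. G ^^ Suc (Suc (2 * n)))"
    unfolding odd_reach_def relcomp_UNION_distrib
    by (simp only: relpow_commute relpow.simps(2) flip: relpow.simps)
  then show "suslin (G O odd_reach G)"
    by (simp only: suslin_UN suslin_relpow_Suc assms)
qed

lemma sym_relpow: "sym R \<Longrightarrow> sym (R ^^ n)"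
proof (induction n)
  case (Suc n)
  then show ?case
    by (metis converse_relcomp relpow.simps(2) relpow_commute sym_conv_converse_eq)
qed (auto simp: sym_def)

lemma sym_odd_reach: "sym G \<Longrightarrow> sym (odd_reach G)"
  unfolding odd_reach_def by (intro sym_UNION ballI sym_relpow)

lemma odd_reach_edge: "G \<subseteq> odd_reach G"
  unfolding odd_reach_def by (rule order_trans[OF _ UN_upper[of 0]]) auto

lemma odd_reach_extend:
  assumes "(a, b) \<in> G" "(b, c) \<in> odd_reach G" "(c, d) \<in> G"
  shows "(a, d) \<in> odd_reach G"
proof -
  obtain n where "(b, c) \<in> G ^^ Suc (2 * n)"
    using assms(2) unfolding odd_reach_def by blast
  then have "(a, d) \<in> G ^^ Suc (Suc (Suc (2 * n)))"
    using assms(1,3) by (metis relpow_Suc_I relpow_Suc_I2)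
  then have "(a, d) \<in> G ^^ Suc (2 * Suc n)"
    by simp
  then show ?thesis
    unfolding odd_reach_def by blast
qed

lemma relpow_imp_walk:
  assumes "(a, b) \<in> G ^^ n"
  obtains p where "walk G p" "walk_length p = n" "hd p = a" "last p = b"
proof -
  obtain w where w: "w 0 = a" "w n = b" "\<forall>i<n. (w i, w (Suc i)) \<in> G"
    using assms unfolding relpow_fun_conv by blast
  show thesis
  proof (rule that[of "map w [0..<Suc n]"])
    show "walk G (map w [0..<Suc n])"
      unfolding walk_def successively_conv_nth using w by (auto simp del: upt_Suc)
    show "hd (map w [0..<Suc n]) = a"
      using w by (simp add: hd_map del: upt_Suc)
  qed (use w in \<open>auto simp: walk_length_def\<close>)
qed

lemma Phi_imp_no_odd_reach:
  assumes "sym G" "Phi G A k"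
  shows "A \<inter> odd_reach G `` A = {}"
proof (rule ccontr)
  assume "A \<inter> odd_reach G `` A \<noteq> {}"
  then obtain a b n where ab: "a \<in> A" "b \<in> A" "(a, b) \<in> G ^^ Suc (2 * n)"
    unfolding odd_reach_def by blast
  then obtain c where "(a, c) \<in> G"
    by (blast elim: relpow_Suc_E2)
  with \<open>sym G\<close> have aca: "(a, c) \<in> G" "(c, a) \<in> G"
    by (auto dest: symD)
  \<comment> \<open>Each detour from a to c and back adds two edges. Taking k detours makes the
    length exceed 2k - 1.\<close>
  have "(a, b) \<in> G ^^ Suc (2 * (n + m))" for m
  proof (induction m)
    case (Suc m)
    then have "(a, b) \<in> G ^^ Suc (Suc (Suc (2 * (n + m))))"
      using aca by (metis relpow_Suc_I2)
    then show ?case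
      by simp
  qed (use ab in simp)
  then obtain p where "walk G p" "walk_length p = Suc (2 * (n + k))" "hd p = a" "last p = b"
    using relpow_imp_walk by metis
  with assms(2) ab have "int (Suc (2 * (n + k))) \<le> 2 * int k - 1"
    unfolding Phi_def by (metis even_Suc even_mult_iff even_numeral)
  then show False
    by simp
qed

section \<open>The colouring\<close>

text \<open>An odd walk between two neighbours of points of \<open>B\<close>, with an edge added at
  each end, is an odd walk between points of \<open>B\<close>.\<close>

lemma neighbours_no_odd_reach:
  assumes "sym G" "B \<inter> odd_reach G `` B = {}"
  shows "G `` B \<inter> odd_reach G `` (G `` B) = {}"
  using assms(2) odd_reach_extend[of _ _ G] symD[OF assms(1)] by fast

lemma borel_bipartite_superset:
  fixes G :: "('a::polish_space \<times> 'a) set"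
  assumes G: "analytic_graph G" and A: "tiny G A"
  obtains P Q where "P \<in> sets borel" "Q \<in> sets borel" "A \<subseteq> P" "G `` P \<subseteq> Q" "G `` Q \<subseteq> P"
    "G \<inter> P \<times> P = {}" "G \<inter> Q \<times> Q = {}"
proof -
  have "sym G" "analytic_set G"
    using G by (auto simp: analytic_graph_def)
  note reach = suslin_odd_reach[OF \<open>analytic_set G\<close>]
  have "suslin G"
    using suslin_relpow_Suc[OF \<open>analytic_set G\<close>, of 0] by simp
  define good where "good = (\<lambda>B. B \<in> sets borel \<and> B \<inter> odd_reach G `` B = {})"
  have "good A"
    using A Phi_imp_no_odd_reach[OF \<open>sym G\<close>] unfolding good_def tiny_def by blast
  \<comment> \<open>The conjunct about n = 0 fixes the start of the sequence, which dependent choice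
    alone leaves open.\<close>
  have "\<exists>B. \<forall>n. (good (B n) \<and> (n = 0 \<longrightarrow> B n = A)) \<and> G `` B n \<subseteq> B (Suc n)"
  proof (rule dependent_nat_choice)
    show "\<exists>B. good B \<and> ((0::nat) = 0 \<longrightarrow> B = A)"
      using \<open>good A\<close> by blast
  next
    fix B :: "'a set" and n :: nat
    assume "good B \<and> (n = 0 \<longrightarrow> B = A)"
    then have B: "B \<in> sets borel" "B \<inter> odd_reach G `` B = {}"
      by (auto simp: good_def)
    have "suslin (odd_reach G `` (G `` B))"
      using suslin_Image_borel[OF reach(2) B(1)] by (simp add: relcomp_Image)
    then obtain B' where "B' \<in> sets borel" "G `` B \<subseteq> B'" "B' \<inter> odd_reach G `` B' = {}"
      using borel_independent_superset[OF reach(1) sym_odd_reach[OF \<open>sym G\<close>]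
          suslin_Image_borel[OF \<open>suslin G\<close> B(1)] _ neighbours_no_odd_reach[OF \<open>sym G\<close> B(2)]]
      by blast
    then show "\<exists>B'. (good B' \<and> (Suc n = 0 \<longrightarrow> B' = A)) \<and> G `` B \<subseteq> B'"
      by (auto simp: good_def)
  qed
  then obtain B where B: "\<And>n. good (B n)" "B 0 = A" "\<And>n. G `` B n \<subseteq> B (Suc n)"
    by blast
  \<comment> \<open>Only isolated vertices can be lost on the way from \<open>B n\<close> to \<open>B (n + 2)\<close>.\<close>
  have up: "B n \<inter> Domain G \<subseteq> B (n + 2 * m)" for n m
  proof (induction m)
    case (Suc m)
    have "B k \<inter> Domain G \<subseteq> B (Suc (Suc k))" for k
      using B(3)[of k] B(3)[of "Suc k"] symD[OF \<open>sym G\<close>] by blast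
    from this[of "n + 2 * m"] Suc show ?case
      by auto
  qed simp
  \<comment> \<open>Adjacent points are not isolated, so if they come from indices of the same
    parity, both survive to a common later index. There the edge between them is an odd walk inside
    a good set.\<close>
  have indep: "False" if "(x, y) \<in> G" "x \<in> B (i + 2 * m)" "y \<in> B (i + 2 * n)" for x y i m n
  proof -
    have "(y, x) \<in> G"
      using that(1) by (rule symD[OF \<open>sym G\<close>])
    with that have "x \<in> B (i + 2 * m + 2 * n)" "y \<in> B (i + 2 * n + 2 * m)"
      using up by blast+
    moreover have "i + 2 * n + 2 * m = i + 2 * m + 2 * n"
      by simp
    ultimately have "\<not> good (B (i + 2 * m + 2 * n))"
      using that(1) odd_reach_edge[of G] unfolding good_def by auto
    with B(1) show False
      by blast
  qed
  show thesis
  proof (rule that)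
    show "(\<Union>n. B (0 + 2 * n)) \<in> sets borel" "(\<Union>n. B (1 + 2 * n)) \<in> sets borel"
      using B(1) unfolding good_def by blast+
    show "A \<subseteq> (\<Union>n. B (0 + 2 * n))"
      using B(2) by (intro order_trans[OF _ UN_upper[of 0]]) auto
    show "G `` (\<Union>n. B (0 + 2 * n)) \<subseteq> (\<Union>n. B (1 + 2 * n))"
      using B(3) by fastforce
    have "G `` B (1 + 2 * n) \<subseteq> B (0 + 2 * Suc n)" for n
      using B(3)[of "1 + 2 * n"] by simp
    then show "G `` (\<Union>n. B (1 + 2 * n)) \<subseteq> (\<Union>n. B (0 + 2 * n))"
      by blast
    show "G \<inter> (\<Union>n. B (0 + 2 * n)) \<times> (\<Union>n. B (0 + 2 * n)) = {}"
      "G \<inter> (\<Union>n. B (1 + 2 * n)) \<times> (\<Union>n. B (1 + 2 * n)) = {}"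
      using indep by blast+
  qed
qed

lemma small_UNIV_imp_borel_coloring:
  fixes G :: "('a::polish_space \<times> 'a) set"
  assumes G: "analytic_graph G" and small: "small G UNIV"
  shows "\<exists>c. borel_coloring G 2 c"
proof -
  obtain \<A> where \<A>: "countable \<A>" "\<And>A. A \<in> \<A> \<Longrightarrow> tiny G A" "\<Union>\<A> = UNIV"
    using small unfolding small_def by metis
  then have "\<A> \<noteq> {}"
    by auto
  with \<A> obtain A :: "nat \<Rightarrow> 'a set" where A: "\<And>n. tiny G (A n)" "(\<Union>n. A n) = UNIV"
    by (metis from_nat_into range_from_nat_into)
  have "\<forall>n. \<exists>P Q. P \<in> sets borel \<and> Q \<in> sets borel \<and> A n \<subseteq> P \<and> G `` P \<subseteq> Q \<and> G `` Q \<subseteq> P \<and>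
    G \<inter> P \<times> P = {} \<and> G \<inter> Q \<times> Q = {}"
    using borel_bipartite_superset[OF G A(1)] by metis
  then obtain P Q where PQ [measurable]: "\<And>n. P n \<in> sets borel" "\<And>n. Q n \<in> sets borel"
    and AP: "\<And>n. A n \<subseteq> P n" and N: "\<And>n. G `` P n \<subseteq> Q n" "\<And>n. G `` Q n \<subseteq> P n"
    and ind: "\<And>n. G \<inter> P n \<times> P n = {}" "\<And>n. G \<inter> Q n \<times> Q n = {}"
    by metis
  define m where "m = (\<lambda>x. LEAST n. x \<in> P n \<union> Q n)"
  define c where "c = (\<lambda>x. if x \<in> P (m x) then 0 else 1 :: nat)"
  have m: "x \<in> P (m x) \<union> Q (m x)" for x
  proof -
    obtain n where "x \<in> A n"
      using A(2) by blast
    then have "x \<in> P n \<union> Q n"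
      using AP by blast
    then show ?thesis
      unfolding m_def by (rule LeastI)
  qed
  have [measurable]: "m \<in> borel \<rightarrow>\<^sub>M count_space UNIV"
    unfolding m_def by measurable
  have [measurable]: "c \<in> borel \<rightarrow>\<^sub>M count_space UNIV"
    unfolding c_def by measurable
  have "c \<in> borel \<rightarrow>\<^sub>M count_space {..<2}"
    by (rule measurable_count_space_extend[of _ UNIV]) (auto simp: c_def)
  moreover have "c x \<noteq> c y" if xy: "(x, y) \<in> G" for x y
  proof -
    have "(y, x) \<in> G"
      using G xy by (auto simp: analytic_graph_def dest: symD)
    \<comment> \<open>Closure under adjacency makes the least index constant along edges.\<close>
    with xy N have "x \<in> P n \<union> Q n \<longleftrightarrow> y \<in> P n \<union> Q n" for n
      by blast
    then have "m x = m y"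
      unfolding m_def by simp
    \<comment> \<open>Equal colours would put both points into \<open>P\<close>, or both into
      \<open>Q\<close>, at their common index, and each of these sets is independent.\<close>
    with m[of x] m[of y] ind[of "m x"] xy show ?thesis
      unfolding c_def by auto
  qed
  ultimately show ?thesis
    unfolding borel_coloring_def by blast
qed

theorem theorem3p3:
  fixes G :: "('a::polish_space \<times> 'a) set"
  assumes "analytic_graph G"
    and "borel_chromatic_number G > 2"
  shows "large G (UNIV :: 'a set)"
proof (rule ccontr)
  assume "\<not> large G (UNIV :: 'a set)"
  then obtain c where "borel_coloring G 2 c"
    using small_UNIV_imp_borel_coloring[OF assms(1)] unfolding large_def by blast
  then have "borel_chromatic_number G \<le> enat 2"
    unfolding borel_chromatic_number_def by (intro Inf_lower) blast
  with assms(2) show False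
    by (simp add: numeral_eq_enat)
qed

end
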